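(* For every positive integer $n$ such that $2n+1-f(n)\ge 1$, one has $f(2n+1-f(n))\ge n$, where $f(n):=R(C_4,K_{1,n})$.
   Context: Graphs are finite, simple and undirected. $G\supseteq H$ means that $H$ is isomorphic to a (not necessarily induced) subgraph of $G$; $\overline{G}$ is the complement of $G$. $C_4$ is the cycle on $4$ vertices and $K_{1,n}$ is the star on $n+1$ vertices (one center joined to $n$ leaves). The Ramsey number $R(H_1,H_2)$ is the smallest integer $N$ such that for every graph $G$ with $N$ vertices, either $G\supseteq H_1$ or $\overline{G}\supseteq H_2$. For a positive integer $n$, $f(n):=R(C_4,K_{1,n})$. *)

theory Defs
  imports Main "HOL-Library.Ramsey"
begin

record 'a graph =
  verts :: "'a set"
  edges :: "'a set set"

text \<open>Finite simple undirected graphs: \<^term>\<open>nsets V 2\<close> is the set of two-element subsets of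
  \<^term>\<open>V\<close>, so there are neither loops nor multiple edges.\<close>

definition fin_graph :: "'a graph \<Rightarrow> bool" where
  "fin_graph G \<longleftrightarrow> finite (verts G) \<and> edges G \<subseteq> nsets (verts G) 2"

definition complement :: "'a graph \<Rightarrow> 'a graph" where
  "complement G = \<lparr>verts = verts G, edges = nsets (verts G) 2 - edges G\<rparr>"

definition subgraph :: "'a graph \<Rightarrow> 'a graph \<Rightarrow> bool" where
  "subgraph S G \<longleftrightarrow> fin_graph S \<and> verts S \<subseteq> verts G \<and> edges S \<subseteq> edges G"

definition isomorphic :: "'a graph \<Rightarrow> 'b graph \<Rightarrow> bool" where
  "isomorphic G H \<longleftrightarrow>
     (\<exists>\<phi>. bij_betw \<phi> (verts G) (verts H) \<and>
          (\<forall>u\<in>verts G. \<forall>v\<in>verts G. {u, v} \<in> edges G \<longleftrightarrow> {\<phi> u, \<phi> v} \<in> edges H))"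

definition contains_graph :: "'a graph \<Rightarrow> 'b graph \<Rightarrow> bool" where
  "contains_graph G H \<longleftrightarrow> (\<exists>S. subgraph S G \<and> isomorphic H S)"

definition C4 :: "nat graph" where
  "C4 = \<lparr>verts = {0, 1, 2, 3}, edges = {{0, 1}, {1, 2}, {2, 3}, {3, 0}}\<rparr>"

definition star :: "nat \<Rightarrow> nat graph" where
  "star n = \<lparr>verts = {0..n}, edges = {{0, i} | i. i \<in> {1..n}}\<rparr>"

text \<open>Every finite graph is isomorphic to one whose vertices are natural numbers, so it is enough
  to let \<^term>\<open>G\<close> range over the latter.\<close>

definition ramsey_number :: "'a graph \<Rightarrow> 'b graph \<Rightarrow> nat" where
  "ramsey_number H1 H2 =
     (LEAST N. \<forall>G :: nat graph. fin_graph G \<and> card (verts G) = N \<longrightarrow>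
        contains_graph G H1 \<or> contains_graph (complement G) H2)"

definition f :: "nat \<Rightarrow> nat" where
  "f n = ramsey_number C4 (star n)"

end

theory Submission
  imports Defs
begin

text \<open>Put \<open>d = f n - 1 - n\<close>. An extremal graph for \<open>f n\<close> has \<open>n + d\<close> vertices, no \<open>C\<^sub>4\<close>,
  and at most \<open>n - 1\<close> non-neighbours at each vertex, so all its degrees are at least \<open>d\<close>. Delete
  a vertex \<open>v\<close> of minimum degree together with \<open>d\<close> of its neighbours; \<open>n - 1\<close> vertices remain.
  Since there is no \<open>C\<^sub>4\<close>, a remaining vertex \<open>w\<close> shares at most one neighbour with \<open>v\<close>, so
  it loses at most one neighbour among the deleted neighbours of \<open>v\<close>. It loses \<open>v\<close> as well only
  if \<open>v\<close> has more than \<open>d\<close> neighbours, and then, \<open>v\<close> having minimum degree, so has \<open>w\<close>.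
  Either way \<open>w\<close> keeps at least \<open>d - 1\<close> of the other \<open>n - 2\<close> vertices as neighbours, and so has
  fewer than \<open>n - d\<close> non-neighbours. This graph on \<open>n - 1\<close> vertices shows \<open>f (n - d) \<ge> n\<close>, and
  \<open>n - d = 2 * n + 1 - f n\<close> (lemma \<open>delete_vertex_with_nbrs\<close>).

  To turn such graphs into statements about \<open>f\<close>, which is a least number, one needs that
  the defining property holds for some number of vertices (two vertices with few
  non-neighbours in a large graph have two common neighbours) and that it persists for larger
  numbers (pass to induced subgraphs); this is lemma \<open>less_f_iff\<close>.\<close>

section \<open>Neighbourhoods\<close>

definition nbrs :: "'a graph \<Rightarrow> 'a \<Rightarrow> 'a set" where
  "nbrs G v = {w. {v, w} \<in> edges G}"

definition induce :: "'a graph \<Rightarrow> 'a set \<Rightarrow> 'a graph" where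
  "induce G W = \<lparr>verts = W, edges = edges G \<inter> nsets W 2\<rparr>"

lemma edgeD:
  assumes "fin_graph G" "{u, v} \<in> edges G"
  shows "u \<in> verts G" "v \<in> verts G" "u \<noteq> v"
proof -
  have "{u, v} \<in> nsets (verts G) 2" using assms unfolding fin_graph_def by blast
  then show "u \<in> verts G" "v \<in> verts G" "u \<noteq> v" by (simp_all add: doubleton_in_nsets_2)
qed

lemma not_in_nbrs_self: "fin_graph G \<Longrightarrow> v \<notin> nbrs G v"
  unfolding nbrs_def using edgeD(3)[of G v v] by blast

lemma finite_nbrs: "fin_graph G \<Longrightarrow> finite (nbrs G v)"
  by (rule finite_subset[of _ "verts G"]) (auto simp: nbrs_def fin_graph_def dest: edgeD)

lemma fin_graph_complement: "fin_graph G \<Longrightarrow> fin_graph (complement G)"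
  by (auto simp: fin_graph_def complement_def)

lemma fin_graph_induce: "fin_graph G \<Longrightarrow> W \<subseteq> verts G \<Longrightarrow> fin_graph (induce G W)"
  by (auto simp: fin_graph_def induce_def intro: finite_subset)

lemma nbrs_complement:
  "v \<in> verts G \<Longrightarrow> nbrs (complement G) v = verts G - insert v (nbrs G v)"
  by (auto simp: nbrs_def complement_def doubleton_in_nsets_2)

lemma nbrs_induce: "v \<in> W \<Longrightarrow> fin_graph G \<Longrightarrow> nbrs (induce G W) v = nbrs G v \<inter> W"
  by (auto simp: nbrs_def induce_def doubleton_in_nsets_2 dest: edgeD)

lemma card_nbrs_complement:
  assumes "fin_graph G" "v \<in> verts G"
  shows "card (nbrs (complement G) v) + card (nbrs G v) + 1 = card (verts G)"
proof -
  have sub: "insert v (nbrs G v) \<subseteq> verts G" and "v \<notin> nbrs G v"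
    using assms not_in_nbrs_self[OF assms(1)] edgeD(2)[OF assms(1)]
    by (auto simp: nbrs_def)
  moreover have fin: "finite (verts G)"
    using assms by (simp add: fin_graph_def)
  moreover have "card (insert v (nbrs G v)) \<le> card (verts G)"
    using fin sub by (rule card_mono)
  ultimately show ?thesis
    using finite_nbrs[OF assms(1), of v]
    by (simp add: nbrs_complement[OF assms(2)] card_Diff_subset)
qed

section \<open>Containment in terms of degrees and common neighbours\<close>

text \<open>The subgraph isomorphic to \<open>H\<close> is the image of \<open>H\<close> with only the images of the edges of
  \<open>H\<close>; further edges of \<open>G\<close> between these vertices do not matter, which is why edges need only
  be preserved and not reflected.\<close>

lemma contains_graph_iff_embedding:
  assumes "fin_graph H"
  shows "contains_graph G H \<longleftrightarrow>
    (\<exists>\<phi>. inj_on \<phi> (verts H) \<and> \<phi> ` verts H \<subseteq> verts G \<and>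
         (\<forall>u v. {u, v} \<in> edges H \<longrightarrow> {\<phi> u, \<phi> v} \<in> edges G))"
    (is "_ \<longleftrightarrow> (\<exists>\<phi>. ?emb \<phi>)")
proof
  assume "contains_graph G H"
  then obtain S \<phi> where S: "subgraph S G" and bij: "bij_betw \<phi> (verts H) (verts S)"
    and iso: "\<forall>u\<in>verts H. \<forall>v\<in>verts H. {u, v} \<in> edges H \<longleftrightarrow> {\<phi> u, \<phi> v} \<in> edges S"
    unfolding contains_graph_def isomorphic_def by (elim exE conjE)
  have "{\<phi> u, \<phi> v} \<in> edges G" if uv: "{u, v} \<in> edges H" for u v
  proof -
    have "{\<phi> u, \<phi> v} \<in> edges S" using iso uv edgeD[OF assms uv] by blast
    then show ?thesis using S by (auto simp: subgraph_def)
  qed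
  moreover have "inj_on \<phi> (verts H)" "\<phi> ` verts H \<subseteq> verts G"
    using bij S by (simp_all add: bij_betw_def subgraph_def)
  ultimately have "?emb \<phi>" by simp
  then show "\<exists>\<phi>. ?emb \<phi>" by (rule exI[of _ \<phi>])
next
  assume "\<exists>\<phi>. ?emb \<phi>"
  then obtain \<phi> where inj: "inj_on \<phi> (verts H)" and im: "\<phi> ` verts H \<subseteq> verts G"
    and hom: "\<forall>u v. {u, v} \<in> edges H \<longrightarrow> {\<phi> u, \<phi> v} \<in> edges G"
    by (elim exE conjE)
  define S where "S = \<lparr>verts = \<phi> ` verts H, edges = (\<lambda>e. \<phi> ` e) ` edges H\<rparr>"
  have edge: "\<exists>u v. e = {u, v} \<and> u \<noteq> v \<and> u \<in> verts H \<and> v \<in> verts H" if "e \<in> edges H" for e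
  proof -
    have "e \<in> nsets (verts H) 2" using that assms unfolding fin_graph_def by blast
    then show ?thesis by (auto simp: nsets_def card_2_iff)
  qed
  have image: "\<phi> ` e \<in> nsets (verts S) 2 \<and> \<phi> ` e \<in> edges G" if e: "e \<in> edges H" for e
  proof -
    obtain u v where uv: "e = {u, v}" "u \<noteq> v" "u \<in> verts H" "v \<in> verts H"
      using edge[OF e] by (elim exE conjE)
    have "\<phi> u \<noteq> \<phi> v" using inj uv by (simp add: inj_on_eq_iff)
    moreover have "{\<phi> u, \<phi> v} \<in> edges G" using hom e unfolding uv(1) by simp
    ultimately show ?thesis
      using uv by (simp add: S_def doubleton_in_nsets_2)
  qed
  then have "edges S \<subseteq> nsets (verts S) 2" "edges S \<subseteq> edges G"
    by (auto simp: S_def)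
  then have sub: "subgraph S G"
    using im assms by (simp add: subgraph_def fin_graph_def S_def)
  have iso: "{u, v} \<in> edges H \<longleftrightarrow> {\<phi> u, \<phi> v} \<in> edges S"
    if uv: "u \<in> verts H" "v \<in> verts H" for u v
  proof
    assume "{u, v} \<in> edges H"
    then have "\<phi> ` {u, v} \<in> (`) \<phi> ` edges H" by (rule imageI)
    then show "{\<phi> u, \<phi> v} \<in> edges S" by (simp add: S_def)
  next
    assume "{\<phi> u, \<phi> v} \<in> edges S"
    then obtain e where e: "e \<in> edges H" "\<phi> ` e = \<phi> ` {u, v}" by (auto simp: S_def)
    moreover have "e \<subseteq> verts H" using edge[OF e(1)] by auto
    ultimately have "e = {u, v}"
      using inj_on_image_eq_iff[OF inj, of e "{u, v}"] uv by simp
    then show "{u, v} \<in> edges H" using e(1) by simp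
  qed
  have "bij_betw \<phi> (verts H) (verts S)" using inj by (simp add: bij_betw_def S_def)
  then have "isomorphic H S"
    using iso unfolding isomorphic_def by (intro exI[of _ \<phi>] conjI ballI)
  then show "contains_graph G H"
    using sub unfolding contains_graph_def by blast
qed

lemma contains_star_iff:
  assumes "fin_graph G"
  shows "contains_graph G (star m) \<longleftrightarrow> (\<exists>v\<in>verts G. m \<le> card (nbrs G v))"
proof -
  have star: "fin_graph (star m)"
    by (auto simp: fin_graph_def star_def doubleton_in_nsets_2)
  have V: "verts (star m) = insert 0 {1..m}"
    unfolding star_def graph.simps by auto
  have E: "{0, i} \<in> edges (star m)" if "i \<in> {1..m}" for i
    using that unfolding star_def graph.simps by blast
  show ?thesis
    unfolding contains_graph_iff_embedding[OF star]
  proof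
    assume "\<exists>\<phi>. inj_on \<phi> (verts (star m)) \<and> \<phi> ` verts (star m) \<subseteq> verts G \<and>
         (\<forall>u v. {u, v} \<in> edges (star m) \<longrightarrow> {\<phi> u, \<phi> v} \<in> edges G)"
    then obtain \<phi> where inj: "inj_on \<phi> (verts (star m))" and im: "\<phi> ` verts (star m) \<subseteq> verts G"
      and hom: "\<forall>u v. {u, v} \<in> edges (star m) \<longrightarrow> {\<phi> u, \<phi> v} \<in> edges G"
      by (elim exE conjE)
    have "\<phi> ` {1..m} \<subseteq> nbrs G (\<phi> 0)"
      unfolding nbrs_def using hom[rule_format, OF E] by blast
    then have "card (\<phi> ` {1..m}) \<le> card (nbrs G (\<phi> 0))"
      using finite_nbrs[OF assms] by (rule card_mono[rotated])
    moreover have "card (\<phi> ` {1..m}) = m"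
      using inj_on_subset[OF inj, of "{1..m}"] V by (simp add: card_image subset_insertI)
    ultimately show "\<exists>v\<in>verts G. m \<le> card (nbrs G v)"
      using im V by (intro bexI[of _ "\<phi> 0"]) auto
  next
    assume "\<exists>v\<in>verts G. m \<le> card (nbrs G v)"
    then obtain v T where v: "v \<in> verts G" and T: "T \<subseteq> nbrs G v" "card T = m"
      by (meson obtain_subset_with_card_n)
    have "finite T" using T finite_nbrs[OF assms] finite_subset by blast
    then obtain h where h: "bij_betw h {1..m} T"
      using ex_bij_betw_nat_finite_1 T(2) by blast
    define \<phi> where "\<phi> = h(0 := v)"
    have T': "v \<notin> T" "T \<subseteq> verts G"
      using T(1) not_in_nbrs_self[OF assms] edgeD(2)[OF assms]
      by (auto simp: nbrs_def)
    have "bij_betw \<phi> {1..m} T"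
      using h by (rule bij_betw_cong[THEN iffD1, rotated]) (simp add: \<phi>_def)
    then have "inj_on \<phi> {1..m}" "\<phi> ` {1..m} = T"
      by (simp_all add: bij_betw_def)
    moreover have \<phi>0: "\<phi> 0 = v" by (simp add: \<phi>_def)
    ultimately have "inj_on \<phi> (verts (star m))" "\<phi> ` verts (star m) \<subseteq> verts G"
      using T' v unfolding V inj_on_insert image_insert by blast+
    moreover have "\<forall>a b. {a, b} \<in> edges (star m) \<longrightarrow> {\<phi> a, \<phi> b} \<in> edges G"
    proof (intro allI impI)
      fix a b assume ab: "{a, b} \<in> edges (star m)"
      have edge: "{\<phi> 0, \<phi> i} \<in> edges G" if "i \<in> {1..m}" for i
      proof -
        have "\<phi> i \<in> nbrs G v" using \<open>\<phi> ` {1..m} = T\<close> T(1) that by blast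
        then show ?thesis by (simp add: nbrs_def \<phi>0)
      qed
      obtain i where i: "i \<in> {1..m}" "{a, b} = {0, i}"
        using ab unfolding star_def graph.simps by blast
      have "\<phi> ` {a, b} = \<phi> ` {0, i}" unfolding i(2) ..
      then have "{\<phi> a, \<phi> b} = {\<phi> 0, \<phi> i}" by simp
      then show "{\<phi> a, \<phi> b} \<in> edges G" using edge[OF i(1)] by simp
    qed
    ultimately show "\<exists>\<phi>. inj_on \<phi> (verts (star m)) \<and> \<phi> ` verts (star m) \<subseteq> verts G \<and>
         (\<forall>u v. {u, v} \<in> edges (star m) \<longrightarrow> {\<phi> u, \<phi> v} \<in> edges G)" by (intro exI[of _ \<phi>] conjI)
  qed
qed

text \<open>Two opposite vertices of a four-cycle are precisely two vertices with two common
  neighbours.\<close>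

lemma contains_C4_iff:
  assumes "fin_graph G"
  shows "contains_graph G C4 \<longleftrightarrow> (\<exists>u v. u \<noteq> v \<and> 2 \<le> card (nbrs G u \<inter> nbrs G v))"
proof -
  have C4: "fin_graph C4"
    by (auto simp: fin_graph_def C4_def doubleton_in_nsets_2)
  show ?thesis
    unfolding contains_graph_iff_embedding[OF C4]
  proof
    assume "\<exists>\<phi>. inj_on \<phi> (verts C4) \<and> \<phi> ` verts C4 \<subseteq> verts G \<and>
         (\<forall>u v. {u, v} \<in> edges C4 \<longrightarrow> {\<phi> u, \<phi> v} \<in> edges G)"
    then obtain \<phi> where inj: "inj_on \<phi> (verts C4)"
      and hom: "\<forall>u v. {u, v} \<in> edges C4 \<longrightarrow> {\<phi> u, \<phi> v} \<in> edges G"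
      by (elim exE conjE)
    have "{0, 1} \<in> edges C4" "{2, 1} \<in> edges C4" "{2, 3} \<in> edges C4" "{0, 3} \<in> edges C4"
      unfolding C4_def by auto
    note this[THEN hom[rule_format]]
    then have "{\<phi> 1, \<phi> 3} \<subseteq> nbrs G (\<phi> 0) \<inter> nbrs G (\<phi> 2)"
      unfolding nbrs_def by blast
    then have "card {\<phi> 1, \<phi> 3} \<le> card (nbrs G (\<phi> 0) \<inter> nbrs G (\<phi> 2))"
      using finite_nbrs[OF assms] by (intro card_mono) auto
    then have "\<phi> 0 \<noteq> \<phi> 2 \<and> 2 \<le> card (nbrs G (\<phi> 0) \<inter> nbrs G (\<phi> 2))"
      using inj by (simp add: C4_def)
    then show "\<exists>u v. u \<noteq> v \<and> 2 \<le> card (nbrs G u \<inter> nbrs G v)" by blast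
  next
    assume "\<exists>u v. u \<noteq> v \<and> 2 \<le> card (nbrs G u \<inter> nbrs G v)"
    then obtain u v T where uv: "u \<noteq> v" and T: "T \<subseteq> nbrs G u \<inter> nbrs G v" "card T = 2"
      by (meson obtain_subset_with_card_n)
    then obtain x y where xy: "T = {x, y}" "x \<noteq> y" by (auto simp: card_2_iff)
    have e: "{u, x} \<in> edges G" "{x, v} \<in> edges G" "{v, y} \<in> edges G" "{y, u} \<in> edges G"
      using T(1) insert_commute[of x v "{}"] insert_commute[of y u "{}"]
      unfolding xy(1) nbrs_def by auto
    define \<phi> :: "nat \<Rightarrow> _" where
      "\<phi> = (\<lambda>i. if i = 0 then u else if i = 1 then x else if i = 2 then v else y)"
    have \<phi>: "\<phi> 0 = u" "\<phi> 1 = x" "\<phi> 2 = v" "\<phi> 3 = y" by (simp_all add: \<phi>_def)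
    have V: "verts C4 = {0, 1, 2, 3}"
      and E: "edges C4 = {{0, 1}, {1, 2}, {2, 3}, {3, 0}}" by (simp_all add: C4_def)
    have "u \<noteq> x" "x \<noteq> v" "v \<noteq> y" "y \<noteq> u" using e edgeD(3)[OF assms] by blast+
    then have "inj_on \<phi> (verts C4)"
      unfolding V inj_on_def ball_simps \<phi> using uv xy(2) by metis
    moreover have "\<phi> ` verts C4 \<subseteq> verts G"
      unfolding V image_insert image_empty \<phi> using e edgeD(1)[OF assms] by blast
    moreover have "\<forall>a b. {a, b} \<in> edges C4 \<longrightarrow> {\<phi> a, \<phi> b} \<in> edges G"
    proof (intro allI impI)
      fix a b assume ab: "{a, b} \<in> edges C4"
      have "\<phi> ` {a, b} \<in> (`) \<phi> ` edges C4" using ab by (rule imageI)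
      also have "\<dots> \<subseteq> edges G"
        unfolding E image_insert image_empty \<phi> using e by blast
      finally show "{\<phi> a, \<phi> b} \<in> edges G" by simp
    qed
    ultimately show "\<exists>\<phi>. inj_on \<phi> (verts C4) \<and> \<phi> ` verts C4 \<subseteq> verts G \<and>
         (\<forall>u v. {u, v} \<in> edges C4 \<longrightarrow> {\<phi> u, \<phi> v} \<in> edges G)" by (intro exI[of _ \<phi>] conjI)
  qed
qed

section \<open>Graphs below the Ramsey number\<close>

definition ramsey_avoiding :: "'a graph \<Rightarrow> nat \<Rightarrow> bool" where
  "ramsey_avoiding G m \<longleftrightarrow>
     fin_graph G \<and> \<not> contains_graph G C4 \<and> \<not> contains_graph (complement G) (star m)"

lemma ramsey_avoiding_iff:
  "ramsey_avoiding G m \<longleftrightarrow> fin_graph G \<and>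
     (\<forall>u v. u \<noteq> v \<longrightarrow> card (nbrs G u \<inter> nbrs G v) \<le> 1) \<and>
     (\<forall>v\<in>verts G. card (nbrs (complement G) v) < m)"
proof (cases "fin_graph G")
  case True
  have V: "verts (complement G) = verts G" by (simp add: complement_def)
  have two: "2 \<le> k \<longleftrightarrow> \<not> k \<le> 1" for k :: nat by linarith
  have "\<not> contains_graph G C4 \<longleftrightarrow> (\<forall>u v. u \<noteq> v \<longrightarrow> card (nbrs G u \<inter> nbrs G v) \<le> 1)"
    unfolding contains_C4_iff[OF True] two by blast
  moreover have "\<not> contains_graph (complement G) (star m) \<longleftrightarrow>
      (\<forall>v\<in>verts G. card (nbrs (complement G) v) < m)"
    unfolding contains_star_iff[OF fin_graph_complement[OF True]] V not_less[symmetric] by blast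
  ultimately show ?thesis by (simp only: ramsey_avoiding_def)
qed (simp add: ramsey_avoiding_def)

lemma card_common_nbrs_induce:
  assumes "fin_graph G" "W \<subseteq> verts G"
  shows "card (nbrs (induce G W) u \<inter> nbrs (induce G W) v) \<le> card (nbrs G u \<inter> nbrs G v)"
  using finite_nbrs[OF assms(1)]
  by (intro card_mono) (auto simp: nbrs_def induce_def)

lemma ramsey_avoiding_induce:
  assumes "ramsey_avoiding G m" "W \<subseteq> verts G"
  shows "ramsey_avoiding (induce G W) m"
proof -
  have fin: "fin_graph G" using assms(1) by (simp add: ramsey_avoiding_iff)
  have "card (nbrs (complement (induce G W)) v) < m" if "v \<in> W" for v
  proof -
    have "nbrs (complement (induce G W)) v \<subseteq> nbrs (complement G) v"
      using that assms(2) by (auto simp: nbrs_def complement_def induce_def doubleton_in_nsets_2)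
    then have "card (nbrs (complement (induce G W)) v) \<le> card (nbrs (complement G) v)"
      using finite_nbrs[OF fin_graph_complement[OF fin]] by (rule card_mono[rotated])
    then show ?thesis
      using assms that unfolding ramsey_avoiding_iff by (meson in_mono le_less_trans)
  qed
  moreover have "verts (induce G W) = W" by (simp add: induce_def)
  moreover have "card (nbrs (induce G W) u \<inter> nbrs (induce G W) v) \<le> 1" if "u \<noteq> v" for u v
  proof -
    have "card (nbrs G u \<inter> nbrs G v) \<le> 1"
      using assms(1) that by (simp add: ramsey_avoiding_iff)
    then show ?thesis using card_common_nbrs_induce[OF fin assms(2), of u v] by linarith
  qed
  ultimately show ?thesis
    using fin_graph_induce[OF fin assms(2)] by (simp add: ramsey_avoiding_iff)
qed

text \<open>A vertex together with its non-neighbours makes up at most \<open>m\<close> vertices. Two such sets leave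
  at least two of \<open>2 * m + 2\<close> vertices uncovered, and uncovered vertices are common neighbours of
  the two chosen vertices. In particular the Ramsey number defining \<open>f m\<close> exists.\<close>

lemma ramsey_avoiding_card_less:
  assumes "ramsey_avoiding G m"
  shows "card (verts G) < 2 * m + 2"
proof (rule ccontr)
  assume "\<not> card (verts G) < 2 * m + 2"
  then have big: "2 * m + 2 \<le> card (verts G)" by simp
  then have "\<exists>T \<subseteq> verts G. card T = 2"
    using obtain_subset_with_card_n[of 2 "verts G"] by auto
  then obtain u v where uv: "u \<noteq> v" "u \<in> verts G" "v \<in> verts G"
    by (auto simp: card_2_iff)
  have fin: "fin_graph G" "finite (verts G)"
    using assms by (simp_all add: ramsey_avoiding_iff fin_graph_def)
  let ?A = "\<lambda>x. insert x (nbrs (complement G) x)"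
  have small: "card (?A x) \<le> m" if "x \<in> verts G" for x
    using assms that finite_nbrs[OF fin_graph_complement[OF fin(1)], of x]
    by (auto simp: ramsey_avoiding_iff card_insert_if)
  have "verts G \<subseteq> (?A u \<union> ?A v) \<union> (nbrs G u \<inter> nbrs G v)"
    using uv by (auto simp: nbrs_complement)
  then have "card (verts G) \<le> card ((?A u \<union> ?A v) \<union> (nbrs G u \<inter> nbrs G v))"
    using finite_nbrs[OF fin(1)] finite_nbrs[OF fin_graph_complement[OF fin(1)]]
    by (intro card_mono) auto
  also have "\<dots> \<le> card (?A u) + card (?A v) + card (nbrs G u \<inter> nbrs G v)"
    by (meson add_le_mono1 card_Un_le le_trans)
  also have "\<dots> \<le> m + m + 1"
  proof -
    have "card (nbrs G u \<inter> nbrs G v) \<le> 1"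
      using assms uv(1) by (simp add: ramsey_avoiding_iff)
    then show ?thesis using small[OF uv(2)] small[OF uv(3)] by linarith
  qed
  finally show False using big by simp
qed

text \<open>The defining property of \<open>f m\<close> passes to larger numbers of vertices, because an avoiding
  graph on more vertices has avoiding induced subgraphs of every smaller size. So the numbers
  below the least one are exactly the orders of avoiding graphs.\<close>

lemma less_f_iff: "N < f m \<longleftrightarrow> (\<exists>G :: nat graph. ramsey_avoiding G m \<and> card (verts G) = N)"
proof -
  define P where "P N \<longleftrightarrow> \<not> (\<exists>G :: nat graph. ramsey_avoiding G m \<and> card (verts G) = N)" for N
  have f: "f m = (LEAST N. P N)"
    unfolding f_def ramsey_number_def P_def ramsey_avoiding_def
    by (rule arg_cong[of _ _ Least]) blast
  have "P (2 * m + 2)"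
    using ramsey_avoiding_card_less by (fastforce simp: P_def)
  then have "P (f m)" unfolding f by (rule LeastI)
  have "P N \<longleftrightarrow> f m \<le> N"
  proof
    assume "P N"
    then show "f m \<le> N" unfolding f by (rule Least_le)
  next
    assume le: "f m \<le> N"
    show "P N"
      unfolding P_def
    proof
      assume "\<exists>G :: nat graph. ramsey_avoiding G m \<and> card (verts G) = N"
      then obtain G :: "nat graph" and W where "ramsey_avoiding G m" "W \<subseteq> verts G" "card W = f m"
        using le by (metis obtain_subset_with_card_n)
      then have "ramsey_avoiding (induce G W) m" "card (verts (induce G W)) = f m"
        using ramsey_avoiding_induce by (auto simp: induce_def)
      then show False using \<open>P (f m)\<close> by (auto simp: P_def)
    qed
  qed
  then show ?thesis unfolding P_def by (metis not_le)
qed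

text \<open>The edgeless graph on \<open>n\<close> vertices is too small for its complement to contain the star.
  This makes \<open>d = f n - 1 - n\<close> a genuine, untruncated difference.\<close>

lemma less_f_self: "n < f n"
proof -
  define G :: "nat graph" where "G = \<lparr>verts = {..<n}, edges = {}\<rparr>"
  have fin: "fin_graph G" by (simp add: G_def fin_graph_def)
  have none: "nbrs G v = {}" for v by (simp add: nbrs_def G_def)
  have "card (nbrs (complement G) v) < n" if "v \<in> verts G" for v
    using card_nbrs_complement[OF fin that] none by (simp add: G_def)
  then have "ramsey_avoiding G n" using fin none by (simp add: ramsey_avoiding_iff)
  moreover have "card (verts G) = n" by (simp add: G_def)
  ultimately show ?thesis unfolding less_f_iff by blast
qed

section \<open>Deleting a vertex of minimum degree and some of its neighbours\<close>

text \<open>Minimality of the degree of the deleted vertex matters: a surviving vertex adjacent to it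
  may lose two neighbours, and minimality supplies the extra one.\<close>

lemma delete_vertex_with_nbrs:
  assumes avoid: "ramsey_avoiding G n" and card: "card (verts G) = n + d" and "d < n"
  shows "\<exists>W \<subseteq> verts G. card W = n - 1 \<and> ramsey_avoiding (induce G W) (n - d)"
proof -
  have fin: "fin_graph G" "finite (verts G)"
    using avoid by (simp_all add: ramsey_avoiding_iff fin_graph_def)
  have common: "card (nbrs G u \<inter> nbrs G v) \<le> 1" if "u \<noteq> v" for u v
    using avoid that by (simp add: ramsey_avoiding_iff)
  have "verts G \<noteq> {}" using card \<open>d < n\<close> by auto
  define v where "v = arg_min_on (\<lambda>w. card (nbrs G w)) (verts G)"
  have v: "v \<in> verts G"
    unfolding v_def by (rule arg_min_if_finite(1)) fact+
  have least: "card (nbrs G v) \<le> card (nbrs G w)" if "w \<in> verts G" for w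
    unfolding v_def by (rule arg_min_least) fact+
  have degree: "d \<le> card (nbrs G w)" if "w \<in> verts G" for w
    using avoid card that card_nbrs_complement[OF fin(1) that]
    by (force simp: ramsey_avoiding_iff)
  then obtain S where S: "S \<subseteq> nbrs G v" "card S = d" "finite S"
    using v by (meson obtain_subset_with_card_n)
  define W where "W = verts G - insert v S"
  have vS: "insert v S \<subseteq> verts G" "v \<notin> S"
    using S(1) v not_in_nbrs_self[OF fin(1)] edgeD(2)[OF fin(1)]
    by (auto simp: nbrs_def)
  then have cardW: "card W = n - 1"
    using S card by (simp add: W_def card_Diff_subset)
  have WV: "W \<subseteq> verts G" by (auto simp: W_def)
  note finW = fin_graph_induce[OF fin(1) WV]
  have "card (nbrs (complement (induce G W)) w) < n - d" if w: "w \<in> W" for w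
  proof -
    have w': "w \<in> verts G" "w \<noteq> v" "w \<notin> S" using w by (auto simp: W_def)
    \<comment> \<open>Neighbours that \<open>w\<close> loses inside \<open>S\<close> are common neighbours of \<open>w\<close> and \<open>v\<close>; the set \<open>L\<close>
      accounts separately for losing \<open>v\<close>, so that both cases can be counted together.\<close>
    define L where "L = (if w \<in> nbrs G v then {v} else {})"
    have "nbrs G w \<subseteq> nbrs (induce G W) w \<union> (nbrs G w \<inter> nbrs G v) \<union> L"
    proof
      fix x assume x: "x \<in> nbrs G w"
      consider "x \<in> W" | "x = v" | "x \<in> S"
        using x edgeD(2)[OF fin(1)] by (auto simp: W_def nbrs_def)
      then show "x \<in> nbrs (induce G W) w \<union> (nbrs G w \<inter> nbrs G v) \<union> L"
      proof cases
        case 1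
        then show ?thesis using x nbrs_induce[OF w fin(1)] by blast
      next
        case 2
        then have "w \<in> nbrs G v" using x by (simp add: nbrs_def insert_commute)
        then show ?thesis using 2 x by (simp add: L_def)
      next
        case 3
        then show ?thesis using x S(1) by blast
      qed
    qed
    then have "card (nbrs G w) \<le> card (nbrs (induce G W) w \<union> (nbrs G w \<inter> nbrs G v) \<union> L)"
      using finite_nbrs[OF fin(1)] finite_nbrs[OF finW] by (intro card_mono) (auto simp: L_def)
    also have "\<dots> \<le> card (nbrs (induce G W) w) + card (nbrs G w \<inter> nbrs G v) + card L"
      by (meson add_le_mono1 card_Un_le le_trans)
    also have "\<dots> \<le> card (nbrs (induce G W) w) + 1 + card L"
      using common[OF w'(2)] by simp
    finally have lost: "card (nbrs G w) \<le> card (nbrs (induce G W) w) + 1 + card L" .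
    have "d + card L \<le> card (nbrs G w)"
    proof (cases "w \<in> nbrs G v")
      case True
      \<comment> \<open>\<open>w\<close> is a neighbour of \<open>v\<close> outside \<open>S\<close>, so \<open>v\<close>, and hence \<open>w\<close>, has degree above \<open>d\<close>.\<close>
      then have "card (insert w S) \<le> card (nbrs G v)"
        using S(1) finite_nbrs[OF fin(1)] by (intro card_mono) auto
      then have "d + 1 \<le> card (nbrs G w)"
        using S w' least[OF w'(1)] by simp
      moreover have "card L \<le> card {v}" by (rule card_mono) (auto simp: L_def)
      ultimately show ?thesis by simp
    next
      case False
      then show ?thesis using degree[OF w'(1)] by (simp add: L_def)
    qed
    then have "d \<le> card (nbrs (induce G W) w) + 1" using lost by simp
    moreover have "card (nbrs (complement (induce G W)) w) + card (nbrs (induce G W) w) + 1 = n - 1"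
      using card_nbrs_complement[OF finW, of w] w cardW by (simp add: induce_def)
    ultimately show ?thesis using \<open>d < n\<close> by linarith
  qed
  moreover have "card (nbrs (induce G W) a \<inter> nbrs (induce G W) b) \<le> 1" if "a \<noteq> b" for a b
    using card_common_nbrs_induce[OF fin(1) WV, of a b] common[OF that] by simp
  moreover have "verts (induce G W) = W" by (simp add: induce_def)
  ultimately have "ramsey_avoiding (induce G W) (n - d)"
    using finW by (simp add: ramsey_avoiding_iff)
  then show ?thesis using WV cardW by blast
qed

theorem corollary7:
  fixes n :: nat
  assumes "n \<ge> 1" and "int (2 * n + 1) - int (f n) \<ge> 1"
  shows "f (2 * n + 1 - f n) \<ge> n"
proof -
  define d where "d = f n - 1 - n"
  have d: "n + d < f n" "d < n" "2 * n + 1 - f n = n - d"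
    using less_f_self[of n] assms by (auto simp: d_def)
  obtain G :: "nat graph" where "ramsey_avoiding G n" "card (verts G) = n + d"
    using d(1) unfolding less_f_iff by blast
  then obtain W where "card W = n - 1" "ramsey_avoiding (induce G W) (n - d)"
    using delete_vertex_with_nbrs d(2) by blast
  moreover have "verts (induce G W) = W" by (simp add: induce_def)
  ultimately have "n - 1 < f (n - d)"
    unfolding less_f_iff by metis
  then show ?thesis using d(3) by simp
qed

end
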